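(* Let $p_n$ be the number of (undecorated) rooted trees with $n$ vertices that are primitive for $\Delta^*$. Then $p_n$ is given by the recursive formula $p_0=0$, $p_1=1$, $p_2=0$ and, for $n\ge2$, $$p_{n+1}=\sum_{k=2}^n\ \sum_{\substack{n_1\ge\cdots\ge n_k\ge1\\ n_1+\cdots+n_k=n}}\ \prod P_{n_i},$$ where $P_{n_i}=\binom{p_{n_i}+k_{n_i}-1}{k_{n_i}}$, $k_{n_i}$ is the number of times $n_i$ appears in the $k$-tuple $(n_1,\dots,n_k)$, and the product is over each distinct value $n_i$ in the tuple.
   Context: $\mathbb{K}$ is a field of characteristic $0$. Rooted trees and forests are finite, undecorated and non-planar (up to isomorphism). $\mathcal{F}$ is the $\mathbb{K}$-vector space freely generated by rooted forests, including the empty forest $\emptyset$. Concatenation (disjoint union) of forests is written by juxtaposition. $B_+$ sends a forest $T_1\cdots T_k$ to the tree obtained by adding a new root linked to the root of each $T_i$. The shuffle product $\mathbin{\sqcup\!\sqcup}^T$ is the bilinear product on $\mathcal{F}$ defined recursively by: $F\mathbin{\sqcup\!\sqcup}^T\emptyset=\emptyset\mathbin{\sqcup\!\sqcup}^T F=F$; if $F=T_1\cdots T_k$, $F'=t_1\cdots t_n$ with non-empty trees, $k,n\ge1$ and $k+n\ge3$, $F\mathbin{\sqcup\!\sqcup}^T F'=\frac1{kn}\sum_{i=1}^k\sum_{j=1}^n(T_i\mathbin{\sqcup\!\sqcup}^T t_j)T_1\cdots\widehat{T_i}\cdots T_k t_1\cdots\widehat{t_j}\cdots t_n$ (hats denote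 omission); and for non-empty trees $T=B_+(f)$, $T'=B_+(f')$, $T\mathbin{\sqcup\!\sqcup}^T T'=B_+(f\mathbin{\sqcup\!\sqcup}^T T')+B_+(T\mathbin{\sqcup\!\sqcup}^T f')$. $\mathcal{F}^\circ$ is the graded dual of $\mathcal{F}$ (graded by number of vertices). A forest $F$ viewed in $\mathcal{F}^\circ$ denotes the dual basis element: $\langle F,F'\rangle=1$ if $F=F'$ and $0$ otherwise. The dual coproduct is defined by $\langle\Delta^*(F),a\otimes b\rangle=\langle F,a\mathbin{\sqcup\!\sqcup}^T b\rangle$. A tree $T$ is primitive for $\Delta^*$ if $\Delta^*(T)=T\otimes\emptyset+\emptyset\otimes T$. Only trees themselves are counted, not linear combinations of trees. *)

theory Defs
  imports Complex_Main "HOL-Library.Multiset" "HOL-Library.Poly_Mapping"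
begin

text \<open>Finite non-planar rooted trees up to isomorphism: a tree is the multiset of the subtrees
  attached to its root.\<close>

datatype tree = Node "tree multiset"

type_synonym forest = "tree multiset"

primrec vertices :: "tree \<Rightarrow> nat" where
  "vertices (Node F) = Suc (\<Sum>\<^sub># (image_mset vertices F))"

definition forest_vertices :: "forest \<Rightarrow> nat" where
  "forest_vertices F = (\<Sum>T\<in>#F. vertices T)"

text \<open>The space spanned by rooted forests is \<open>forest \<Rightarrow>\<^sub>0 'k\<close>. The product that
  \<open>Poly_Mapping\<close> puts on it is the convolution along \<open>+\<close> of multisets, that is, the
  bilinear extension of the concatenation of forests; its unit is the empty forest.\<close>

abbreviation basis :: "'b \<Rightarrow> ('b \<Rightarrow>\<^sub>0 'k::field_char_0)" where
  "basis b \<equiv> Poly_Mapping.single b 1"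

abbreviation scale :: "'k::field_char_0 \<Rightarrow> ('b \<Rightarrow>\<^sub>0 'k) \<Rightarrow> ('b \<Rightarrow>\<^sub>0 'k)" where
  "scale c x \<equiv> Poly_Mapping.map ((*) c) x"

definition B_plus :: "(forest \<Rightarrow>\<^sub>0 'k::field_char_0) \<Rightarrow> (forest \<Rightarrow>\<^sub>0 'k)" where
  "B_plus x = (\<Sum>F\<in>Poly_Mapping.keys x. scale (Poly_Mapping.lookup x F) (basis {#Node F#}))"

lemma forest_vertices_simps [simp]:
  "forest_vertices {#} = 0"
  "forest_vertices (add_mset T F) = vertices T + forest_vertices F"
  "forest_vertices (F + G) = forest_vertices F + forest_vertices G"
  by (auto simp: forest_vertices_def)

lemma vertices_Node: "vertices (Node F) = Suc (forest_vertices F)"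
  by (simp add: forest_vertices_def)

lemma vertices_pos: "vertices T > 0"
  by (cases T) simp

lemma forest_vertices_member: "T \<in># F \<Longrightarrow> forest_vertices F = vertices T + forest_vertices (F - {#T#})"
  by (metis forest_vertices_simps(2) insert_DiffM)

lemma forest_vertices_eq_0 [simp]: "forest_vertices F = 0 \<longleftrightarrow> F = {#}"
  by (cases F) (use vertices_pos in auto)

lemma forest_vertices_drop_less:
  assumes "T \<in># F" "size F \<ge> 2"
  shows "vertices T < forest_vertices F"
proof -
  have "F - {#T#} \<noteq> {#}"
    using assms by (metis One_nat_def Suc_1 Suc_n_not_le_n size_Diff_singleton size_empty
        diff_is_0_eq insert_DiffM size_single)
  then show ?thesis
    using forest_vertices_member[OF assms(1)] by (cases "F - {#T#}") (use vertices_pos in auto)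
qed

text \<open>The shuffle of two forests. The sums range over trees with multiplicity, i.e. over the
  positions \<open>i\<close> and \<open>j\<close>.\<close>

function shuffle_forest :: "forest \<Rightarrow> forest \<Rightarrow> (forest \<Rightarrow>\<^sub>0 'k::field_char_0)" where
  "shuffle_forest F {#} = basis F"
| "shuffle_forest {#} F' = basis F'"
| "F \<noteq> {#} \<Longrightarrow> F' \<noteq> {#} \<Longrightarrow> size F + size F' \<ge> 3 \<Longrightarrow>
   shuffle_forest F F' = scale (1 / (of_nat (size F) * of_nat (size F')))
     (\<Sum>T\<in>#F. \<Sum>t\<in>#F'. shuffle_forest {#T#} {#t#} * basis ((F - {#T#}) + (F' - {#t#})))"
| "shuffle_forest {#Node f#} {#Node f'#} =
     B_plus (shuffle_forest f {#Node f'#}) + B_plus (shuffle_forest {#Node f#} f')"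
proof -
  fix P :: bool and x :: "forest \<times> forest"
  assume 1: "\<And>F. x = (F, {#}) \<Longrightarrow> P" and 2: "\<And>F'. x = ({#}, F') \<Longrightarrow> P"
    and 3: "\<And>F F'. F \<noteq> {#} \<Longrightarrow> F' \<noteq> {#} \<Longrightarrow> 3 \<le> size F + size F' \<Longrightarrow> x = (F, F') \<Longrightarrow> P"
    and 4: "\<And>f f'. x = ({#Node f#}, {#Node f'#}) \<Longrightarrow> P"
  obtain F F' where x: "x = (F, F')" by force
  show P
  proof (cases "F = {#} \<or> F' = {#} \<or> size F + size F' \<ge> 3")
    case True
    then show ?thesis using 1 2 3 x by blast
  next
    case False
    then have "size F > 0" "size F' > 0" "size F + size F' < 3" by (auto simp: nonempty_has_size)
    then have "size F = 1" "size F' = 1" by linarith+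
    then obtain T T' where "F = {#T#}" "F' = {#T'#}" by (metis One_nat_def size_1_singleton_mset)
    then show ?thesis using 4 x by (metis tree.exhaust)
  qed
qed auto

termination
proof (relation "measure (\<lambda>(F, F'). forest_vertices F + forest_vertices F')")
  fix F F' :: forest and T t
  assume *: "F \<noteq> {#}" "F' \<noteq> {#}" "3 \<le> size F + size F'" "T \<in># F" "t \<in># F'"
  have "vertices T + vertices t < forest_vertices F + forest_vertices F'"
  proof (cases "size F \<ge> 2")
    case True
    then show ?thesis
      using forest_vertices_drop_less[OF *(4)] forest_vertices_member[OF *(5)] by linarith
  next
    case False
    then have "size F' \<ge> 2" using *(3) by linarith
    then show ?thesis
      using forest_vertices_drop_less[OF *(5)] forest_vertices_member[OF *(4)] by linarith
  qed
  then show "(({#T#}, {#t#}), (F, F')) \<in> measure (\<lambda>(F, F'). forest_vertices F + forest_vertices F')"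
    by simp
qed (auto simp: vertices_Node simp del: vertices.simps)

definition shuffle :: "(forest \<Rightarrow>\<^sub>0 'k::field_char_0) \<Rightarrow> (forest \<Rightarrow>\<^sub>0 'k) \<Rightarrow> (forest \<Rightarrow>\<^sub>0 'k)" where
  "shuffle x y =
     (\<Sum>F\<in>Poly_Mapping.keys x. \<Sum>G\<in>Poly_Mapping.keys y. scale (Poly_Mapping.lookup x F * Poly_Mapping.lookup y G) (shuffle_forest F G))"

text \<open>There are finitely many forests with a given number of vertices, so the graded dual is
  spanned by the dual basis. Its elements are represented by their coordinates in the dual basis,
  hence again as elements of \<open>forest \<Rightarrow>\<^sub>0 'k\<close>, and \<open>basis F\<close>, read as an
  element of the dual, is the form dual to \<open>F\<close>. Likewise the tensor square of the space of
  forests, or of its graded dual, is \<open>forest \<times> forest \<Rightarrow>\<^sub>0 'k\<close>, where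
  \<open>basis (F, G)\<close> is the tensor of the basis elements of \<open>F\<close> and
  \<open>G\<close>.\<close>

lemma finite_forests: "finite {F. forest_vertices F = n}"
proof (induction n rule: less_induct)
  case (less n)
  let ?S = "\<Union>m<n. {F. forest_vertices F = m}"
  have fin: "finite ?S" using less by blast
  have "{F. forest_vertices F = n} \<subseteq> insert {#} ((\<lambda>(G, H). add_mset (Node G) H) ` (?S \<times> ?S))"
  proof
    fix F assume "F \<in> {F. forest_vertices F = n}"
    then have n: "forest_vertices F = n" by simp
    show "F \<in> insert {#} ((\<lambda>(G, H). add_mset (Node G) H) ` (?S \<times> ?S))"
    proof (cases F)
      case (add T H)
      obtain G where T: "T = Node G" by (cases T)
      have "forest_vertices G < n" "forest_vertices H < n"
        using n add T by (auto simp: vertices_Node simp del: vertices.simps)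
      then show ?thesis using add T by force
    qed simp
  qed
  then show ?case using fin by (meson finite_SigmaI finite_imageI finite_insert finite_subset)
qed

definition pairing :: "('b \<Rightarrow>\<^sub>0 'k::field_char_0) \<Rightarrow> ('b \<Rightarrow>\<^sub>0 'k) \<Rightarrow> 'k" where
  "pairing \<phi> x = (\<Sum>b\<in>Poly_Mapping.keys x. Poly_Mapping.lookup \<phi> b * Poly_Mapping.lookup x b)"

lemma lookup_scale [simp]: "Poly_Mapping.lookup (scale c x) b = c * Poly_Mapping.lookup x b"
  by (simp add: Poly_Mapping.map.rep_eq when_def)

lemma pairing_sum_right:
  fixes \<phi> :: "'b \<Rightarrow>\<^sub>0 'k::field_char_0"
  shows "pairing \<phi> (\<Sum>i\<in>I. f i) = (\<Sum>i\<in>I. pairing \<phi> (f i))"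
proof (cases "finite I")
  case True
  have eq: "pairing \<phi> x = (\<Sum>b\<in>S. Poly_Mapping.lookup \<phi> b * Poly_Mapping.lookup x b)"
    if "finite S" "Poly_Mapping.keys x \<subseteq> S" for x :: "'b \<Rightarrow>\<^sub>0 'k" and S
    unfolding pairing_def using that
    by (intro sum.mono_neutral_left) (auto simp: in_keys_iff)
  define S where "S = (\<Union>i\<in>I. Poly_Mapping.keys (f i))"
  have S: "finite S" using True by (simp add: S_def)
  have "pairing \<phi> (\<Sum>i\<in>I. f i) =
      (\<Sum>b\<in>S. Poly_Mapping.lookup \<phi> b * (\<Sum>i\<in>I. Poly_Mapping.lookup (f i) b))"
    using eq[OF S, of "\<Sum>i\<in>I. f i"] keys_sum[of f I] by (simp add: S_def lookup_sum)
  also have "\<dots> = (\<Sum>i\<in>I. \<Sum>b\<in>S. Poly_Mapping.lookup \<phi> b * Poly_Mapping.lookup (f i) b)"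
    by (subst sum.swap) (simp add: sum_distrib_left)
  also have "\<dots> = (\<Sum>i\<in>I. pairing \<phi> (f i))"
    by (intro sum.cong refl eq[symmetric] S) (auto simp: S_def)
  finally show ?thesis .
qed (simp add: pairing_def)

lemma pairing_scale_right: "pairing \<phi> (scale c x) = c * pairing \<phi> x"
proof (cases "c = 0")
  case True
  then have "scale c x = 0" by (intro poly_mapping_eqI) simp
  then show ?thesis using True by (simp add: pairing_def)
next
  case False
  then have "Poly_Mapping.keys (scale c x) = Poly_Mapping.keys x" by (auto simp: in_keys_iff)
  then show ?thesis by (simp add: pairing_def sum_distrib_left mult_ac)
qed

lemma pairing_single_right [simp]:
  "pairing \<phi> (Poly_Mapping.single b c) = c * Poly_Mapping.lookup \<phi> b"
  by (simp add: pairing_def)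

lemma keys_B_plus:
  assumes "G \<in> Poly_Mapping.keys (B_plus x)"
  obtains F where "F \<in> Poly_Mapping.keys x" "G = {#Node F#}"
proof -
  have "(\<Sum>F\<in>Poly_Mapping.keys x. Poly_Mapping.lookup x F * Poly_Mapping.lookup (basis {#Node F#}) G) \<noteq> 0"
    using assms by (simp add: B_plus_def in_keys_iff lookup_sum del: map_single)
  then obtain F where "F \<in> Poly_Mapping.keys x" "Poly_Mapping.lookup (basis {#Node F#} :: _ \<Rightarrow>\<^sub>0 'a) G \<noteq> 0"
    by (metis (no_types, lifting) mult_eq_0_iff sum.not_neutral_contains_not_neutral)
  then show ?thesis using that by (auto simp: lookup_single when_def split: if_splits)
qed

lemma keys_sum_mset:
  "G \<in> Poly_Mapping.keys (\<Sum>i\<in>#M. f i) \<Longrightarrow> \<exists>i\<in>#M. G \<in> Poly_Mapping.keys (f i)"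
  by (induction M) (use keys_add in fastforce)+

text \<open>The shuffle product is homogeneous; hence its transpose preserves the graded dual, and
  the coproduct below is well defined.\<close>

lemma shuffle_forest_homogeneous:
  "G \<in> Poly_Mapping.keys (shuffle_forest A B :: forest \<Rightarrow>\<^sub>0 'k::field_char_0)
   \<Longrightarrow> forest_vertices G = forest_vertices A + forest_vertices B"
proof (induction A B arbitrary: G rule: shuffle_forest.induct)
  case (3 F F')
  have "G \<in> Poly_Mapping.keys (\<Sum>T\<in>#F. \<Sum>t\<in>#F'.
      (shuffle_forest {#T#} {#t#} :: forest \<Rightarrow>\<^sub>0 'k) * basis ((F - {#T#}) + (F' - {#t#})))"
    using "3.prems" 3(1-3) by (simp add: in_keys_iff)
  then obtain T t where Tt: "T \<in># F" "t \<in># F'" "G \<in> Poly_Mapping.keys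
      ((shuffle_forest {#T#} {#t#} :: forest \<Rightarrow>\<^sub>0 'k) * basis ((F - {#T#}) + (F' - {#t#})))"
    by (metis (no_types, lifting) keys_sum_mset)
  then obtain H where H: "H \<in> Poly_Mapping.keys (shuffle_forest {#T#} {#t#} :: forest \<Rightarrow>\<^sub>0 'k)"
    "G = H + ((F - {#T#}) + (F' - {#t#}))"
    using keys_mult[of "shuffle_forest {#T#} {#t#} :: forest \<Rightarrow>\<^sub>0 'k"
        "basis ((F - {#T#}) + (F' - {#t#}))"] by auto
  show ?case
    using "3.IH"[OF Tt(1,2) H(1)] H(2) forest_vertices_member[OF Tt(1)]
      forest_vertices_member[OF Tt(2)] by simp
next
  case (4 f f')
  have "G \<in> Poly_Mapping.keys (B_plus (shuffle_forest f {#Node f'#} :: forest \<Rightarrow>\<^sub>0 'k)) \<union>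
      Poly_Mapping.keys (B_plus (shuffle_forest {#Node f#} f' :: forest \<Rightarrow>\<^sub>0 'k))"
    using "4.prems" keys_add by fastforce
  then show ?case
    using "4.IH" by (auto elim!: keys_B_plus simp: vertices_Node simp del: vertices.simps)
qed auto

definition tensor ::
  "('b \<Rightarrow>\<^sub>0 'k::field_char_0) \<Rightarrow> ('c \<Rightarrow>\<^sub>0 'k) \<Rightarrow> ('b \<times> 'c \<Rightarrow>\<^sub>0 'k)" where
  "tensor x y = (\<Sum>b\<in>Poly_Mapping.keys x. \<Sum>c\<in>Poly_Mapping.keys y. scale (Poly_Mapping.lookup x b * Poly_Mapping.lookup y c) (basis (b, c)))"

lemma pairing_tensor_right:
  "pairing D (tensor a b) = (\<Sum>F\<in>Poly_Mapping.keys a. \<Sum>G\<in>Poly_Mapping.keys b.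
     Poly_Mapping.lookup a F * Poly_Mapping.lookup b G * Poly_Mapping.lookup D (F, G))"
  by (simp add: tensor_def pairing_sum_right pairing_scale_right)

lemma coproduct_unique_existence:
  "\<exists>!D. \<forall>a b. pairing D (tensor a b) = pairing \<phi> (shuffle a b)"
proof (rule ex_ex1I)
  define d where "d = (\<lambda>(A, B). pairing \<phi> (shuffle_forest A B))"
  define S where "S = (\<Union>F\<in>Poly_Mapping.keys \<phi>. \<Union>m\<le>forest_vertices F. {A. forest_vertices A = m})"
  have "finite S" using finite_forests by (simp add: S_def)
  moreover have "{p. d p \<noteq> 0} \<subseteq> S \<times> S"
  proof clarify
    fix A B assume "d (A, B) \<noteq> 0"
    then obtain F where "F \<in> Poly_Mapping.keys (shuffle_forest A B :: forest \<Rightarrow>\<^sub>0 'a)"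
      "Poly_Mapping.lookup \<phi> F \<noteq> 0"
      unfolding d_def pairing_def prod.case by (metis (no_types, lifting) mult_eq_0_iff sum.not_neutral_contains_not_neutral)
    moreover from this(1) have "forest_vertices F = forest_vertices A + forest_vertices B"
      by (rule shuffle_forest_homogeneous)
    ultimately have "F \<in> Poly_Mapping.keys \<phi>" "forest_vertices A \<le> forest_vertices F"
      "forest_vertices B \<le> forest_vertices F"
      by (simp_all add: in_keys_iff)
    then show "A \<in> S \<and> B \<in> S" unfolding S_def by blast
  qed
  ultimately have "finite {p. d p \<noteq> 0}" using finite_subset by blast
  then have "Poly_Mapping.lookup (Abs_poly_mapping d) = d" by simp
  then have "pairing (Abs_poly_mapping d) (tensor a b) = pairing \<phi> (shuffle a b)" for a b
    by (simp add: pairing_tensor_right shuffle_def pairing_sum_right pairing_scale_right d_def)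
  then show "\<exists>D. \<forall>a b. pairing D (tensor a b) = pairing \<phi> (shuffle a b)" by blast
next
  fix D D' :: "forest \<times> forest \<Rightarrow>\<^sub>0 'a"
  assume D: "\<forall>a b. pairing D (tensor a b) = pairing \<phi> (shuffle a b)"
    and D': "\<forall>a b. pairing D' (tensor a b) = pairing \<phi> (shuffle a b)"
  show "D = D'"
  proof (rule poly_mapping_eqI)
    fix p :: "forest \<times> forest"
    have *: "pairing E (tensor (basis (fst p)) (basis (snd p))) = Poly_Mapping.lookup E p" for E :: "forest \<times> forest \<Rightarrow>\<^sub>0 'a"
      by (simp add: pairing_tensor_right)
    show "Poly_Mapping.lookup D p = Poly_Mapping.lookup D' p"
      using D D' * by metis
  qed
qed

definition coproduct ::
  "(forest \<Rightarrow>\<^sub>0 'k::field_char_0) \<Rightarrow> (forest \<times> forest \<Rightarrow>\<^sub>0 'k)" where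
  "coproduct \<phi> = (THE D. \<forall>a b. pairing D (tensor a b) = pairing \<phi> (shuffle a b))"

lemma pairing_coproduct: "pairing (coproduct \<phi>) (tensor a b) = pairing \<phi> (shuffle a b)"
  using theI'[OF coproduct_unique_existence[of \<phi>]] by (simp add: coproduct_def)

definition primitive_tree :: "'k::field_char_0 itself \<Rightarrow> tree \<Rightarrow> bool" where
  "primitive_tree _ T \<longleftrightarrow>
     coproduct (basis {#T#} :: forest \<Rightarrow>\<^sub>0 'k)
       = tensor (basis {#T#}) (basis {#}) + tensor (basis {#}) (basis {#T#})"

definition num_primitive_trees :: "'k::field_char_0 itself \<Rightarrow> nat \<Rightarrow> nat" where
  "num_primitive_trees K n = card {T. vertices T = n \<and> primitive_tree K T}"

end

theory Submission
  imports Defs "HOL-Library.FuncSet"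
begin

text \<open>Transposing the coproduct, a tree \<open>T\<close> is primitive iff it has coefficient \<open>0\<close> in every
  shuffle of two non-empty forests. Two observations turn this into a combinatorial condition.

  All structure constants of the shuffle are non-negative rationals, so no cancellation ever takes
  place: the support of a shuffle is obtained by replacing every sum in the recursive definition by
  a union and dropping the positive factors. A shuffle of forests with \<open>k, l \<ge> 1\<close> trees is
  supported on forests with \<open>k + l - 1\<close> trees, so only shuffles of two trees matter for \<open>T\<close>.

  For \<open>T = Node G\<close> the shuffle of two trees strips one of the two roots, so \<open>T\<close> fails to be
  primitive iff \<open>G\<close> occurs in the shuffle of some forest \<open>f\<close> with some tree \<open>t\<close>. If \<open>f\<close> is empty
  or a tree, this produces exactly the case that \<open>G\<close> is a single tree. If \<open>f\<close> has at least two
  trees, the shuffle merges one tree of \<open>f\<close> with \<open>t\<close> and leaves the others untouched, so \<open>G\<close>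
  occurs iff one of its trees occurs in a shuffle of two trees, that is, is not primitive. Hence
  \<open>Node G\<close> is primitive iff \<open>G\<close> does not consist of exactly one tree and all trees of \<open>G\<close> are
  primitive (\<open>primitive_tree_Node_iff\<close>).

  The primitive trees with \<open>n + 1\<close> vertices are thus the multisets of primitive trees with
  \<open>n\<close> vertices in total and, for \<open>n \<ge> 2\<close>, at least two members. They are sorted by the numbers of
  vertices of their members; for a given list of such numbers, the trees with \<open>m\<close> vertices can be
  chosen independently for each value \<open>m\<close>, as a multiset drawn from the \<open>p m\<close> primitive ones
  (\<open>card_multisets_with_image\<close>).\<close>

section \<open>Supports of elements with non-negative rational coefficients\<close>

text \<open>The base field carries no order, so "non-negative" is expressed through its prime field.\<close>

definition nonneg_rationals :: "'k::field_char_0 set" where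
  "nonneg_rationals = of_rat ` {0..}"

lemma nonneg_rationals_0 [simp]: "0 \<in> nonneg_rationals"
  and nonneg_rationals_1 [simp]: "1 \<in> nonneg_rationals"
  unfolding nonneg_rationals_def by (rule image_eqI[of _ _ 0], simp, simp) (rule image_eqI[of _ _ 1], simp, simp)

lemma nonneg_rationals_add: "a + b \<in> nonneg_rationals"
  and nonneg_rationals_mult: "a * b \<in> nonneg_rationals"
  if "a \<in> nonneg_rationals" "b \<in> nonneg_rationals"
  using that by (auto simp: nonneg_rationals_def simp flip: of_rat_add of_rat_mult)

lemma nonneg_rationals_inverse_of_nat: "1 / (of_nat m * of_nat n) \<in> nonneg_rationals"
  by (auto simp: nonneg_rationals_def of_rat_divide of_rat_mult
      intro!: image_eqI[where x = "1 / (of_nat m * of_nat n)"])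

lemma nonneg_rationals_add_eq_0_iff:
  "a \<in> nonneg_rationals \<Longrightarrow> b \<in> nonneg_rationals \<Longrightarrow> a + b = 0 \<longleftrightarrow> a = 0 \<and> b = 0"
  by (auto simp: nonneg_rationals_def add_nonneg_eq_0_iff simp flip: of_rat_add)

definition nonneg_coeffs :: "('b \<Rightarrow>\<^sub>0 'k::field_char_0) \<Rightarrow> bool" where
  "nonneg_coeffs x \<longleftrightarrow> (\<forall>b. Poly_Mapping.lookup x b \<in> nonneg_rationals)"

lemma nonneg_coeffs_basis [simp]: "nonneg_coeffs (basis b)"
  by (simp add: nonneg_coeffs_def lookup_single when_def)

lemma nonneg_coeffs_add: "nonneg_coeffs x \<Longrightarrow> nonneg_coeffs y \<Longrightarrow> nonneg_coeffs (x + y)"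
  by (simp add: nonneg_coeffs_def lookup_add nonneg_rationals_add)

text \<open>In general cancellation only leaves an inclusion here; non-negativity excludes it.\<close>

lemma keys_add_nonneg:
  "nonneg_coeffs x \<Longrightarrow> nonneg_coeffs y \<Longrightarrow>
    Poly_Mapping.keys (x + y) = Poly_Mapping.keys x \<union> Poly_Mapping.keys y"
  by (auto simp: nonneg_coeffs_def in_keys_iff lookup_add nonneg_rationals_add_eq_0_iff)

lemma nonneg_coeffs_sum_mset:
  "(\<And>i. i \<in># M \<Longrightarrow> nonneg_coeffs (f i)) \<Longrightarrow> nonneg_coeffs (\<Sum>i\<in>#M. f i)"
  by (induction M) (auto intro: nonneg_coeffs_add simp: nonneg_coeffs_def[of 0])

lemma keys_sum_mset_nonneg:
  "(\<And>i. i \<in># M \<Longrightarrow> nonneg_coeffs (f i)) \<Longrightarrow>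
    Poly_Mapping.keys (\<Sum>i\<in>#M. f i) = (\<Union>i\<in>set_mset M. Poly_Mapping.keys (f i))"
  by (induction M) (auto simp: keys_add_nonneg nonneg_coeffs_sum_mset)

lemma nonneg_coeffs_scale:
  "c \<in> nonneg_rationals \<Longrightarrow> nonneg_coeffs x \<Longrightarrow> nonneg_coeffs (scale c x)"
  by (simp add: nonneg_coeffs_def nonneg_rationals_mult)

lemma keys_scale: "c \<noteq> 0 \<Longrightarrow> Poly_Mapping.keys (scale c x) = Poly_Mapping.keys x"
  by (auto simp: in_keys_iff)

text \<open>Adding \<open>H\<close> is injective on multisets, so multiplying by \<open>basis H\<close> merely shifts coefficients.\<close>

lemma lookup_mult_basis:
  fixes x :: "'a multiset \<Rightarrow>\<^sub>0 'k::field_char_0"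
  shows "Poly_Mapping.lookup (x * basis H) G = (if H \<subseteq># G then Poly_Mapping.lookup x (G - H) else 0)"
proof -
  have "G = F + H \<longleftrightarrow> F = G - H \<and> H \<subseteq># G" for F
    by (auto simp: subset_mset.diff_add)
  then have "(\<Sum>K. Poly_Mapping.lookup (basis H :: _ \<Rightarrow>\<^sub>0 'k) K when G = F + K) =
      (1 when H \<subseteq># G when F = G - H)" for F
    by (simp add: lookup_single when_commute[of _ "H = _"]) (simp add: when_def)
  then show ?thesis
    by (simp add: lookup_mult mult_when)
qed

lemma keys_mult_basis:
  fixes x :: "'a multiset \<Rightarrow>\<^sub>0 'k::field_char_0"
  shows "Poly_Mapping.keys (x * basis H) = (\<lambda>F. F + H) ` Poly_Mapping.keys x"
  by (force simp: in_keys_iff lookup_mult_basis subset_mset.diff_add split: if_splits)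

lemma nonneg_coeffs_mult_basis:
  fixes x :: "'a multiset \<Rightarrow>\<^sub>0 'k::field_char_0"
  shows "nonneg_coeffs x \<Longrightarrow> nonneg_coeffs (x * basis H)"
  by (simp add: nonneg_coeffs_def lookup_mult_basis)

lemma lookup_B_plus:
  "Poly_Mapping.lookup (B_plus x) G = (\<Sum>F\<in>Poly_Mapping.keys x. if G = {#Node F#} then Poly_Mapping.lookup x F else 0)"
  by (auto simp: B_plus_def lookup_sum lookup_single when_def simp del: map_single intro!: sum.cong)

lemma lookup_B_plus_Node [simp]: "Poly_Mapping.lookup (B_plus x) {#Node F#} = Poly_Mapping.lookup x F"
  by (simp add: lookup_B_plus in_keys_iff)

lemma keys_B_plus_eq: "Poly_Mapping.keys (B_plus x) = (\<lambda>F. {#Node F#}) ` Poly_Mapping.keys x"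
  by (auto elim!: keys_B_plus simp: in_keys_iff)

lemma nonneg_coeffs_B_plus:
  assumes "nonneg_coeffs x"
  shows "nonneg_coeffs (B_plus x)"
proof -
  have "Poly_Mapping.lookup (B_plus x) G \<in> nonneg_rationals" for G
  proof (cases "G \<in> Poly_Mapping.keys (B_plus x)")
    case True
    then show ?thesis using assms by (auto elim!: keys_B_plus simp: nonneg_coeffs_def)
  qed (simp add: in_keys_iff)
  then show ?thesis by (simp add: nonneg_coeffs_def)
qed

section \<open>Supports of shuffles\<close>

lemma nonneg_coeffs_shuffle_forest:
  "nonneg_coeffs (shuffle_forest A B :: forest \<Rightarrow>\<^sub>0 'k::field_char_0)"
proof (induction A B rule: shuffle_forest.induct)
  case (3 F F')
  then show ?case
    by (auto intro!: nonneg_coeffs_scale nonneg_coeffs_sum_mset nonneg_coeffs_mult_basis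
        nonneg_rationals_inverse_of_nat)
next
  case (4 f f')
  then show ?case by (auto intro!: nonneg_coeffs_add nonneg_coeffs_B_plus)
qed auto

lemma shuffle_forest_commute:
  "(shuffle_forest A B :: forest \<Rightarrow>\<^sub>0 'k::field_char_0) = shuffle_forest B A"
proof (induction A B rule: shuffle_forest.induct)
  case (2 F')
  then show ?case by (cases "F' = {#}") auto
next
  case (1 F)
  then show ?case by (cases "F = {#}") auto
next
  case (3 F F')
  have "(\<Sum>T\<in>#F. \<Sum>t\<in>#F'. shuffle_forest {#T#} {#t#} * basis ((F - {#T#}) + (F' - {#t#})))
      = (\<Sum>T\<in>#F. \<Sum>t\<in>#F'. shuffle_forest {#t#} {#T#} * (basis ((F' - {#t#}) + (F - {#T#})) :: forest \<Rightarrow>\<^sub>0 'k))"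
    by (intro arg_cong[where f = sum_mset] image_mset_cong)
      (intro arg_cong2[where f = "(*)"] 3(4) arg_cong[where f = basis] add.commute)
  also have "\<dots> = (\<Sum>t\<in>#F'. \<Sum>T\<in>#F. shuffle_forest {#t#} {#T#} * (basis ((F' - {#t#}) + (F - {#T#})) :: forest \<Rightarrow>\<^sub>0 'k))"
    by (rule sum_mset.swap)
  finally show ?case using 3(1-3) by (simp add: add.commute mult.commute)
next
  case (4 f f')
  then show ?case by (simp add: add.commute)
qed

text \<open>The first of the two recursions that the supports inherit from the shuffle, and the reason for
  tracking signs: both the double sum and the sum of two grafted terms become unions.\<close>

lemma keys_shuffle_forest:
  assumes "F \<noteq> {#}" "F' \<noteq> {#}" "size F + size F' \<ge> 3"
  shows "Poly_Mapping.keys (shuffle_forest F F' :: forest \<Rightarrow>\<^sub>0 'k::field_char_0) =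
    (\<Union>T\<in>set_mset F. \<Union>t\<in>set_mset F'. (\<lambda>H. H + ((F - {#T#}) + (F' - {#t#}))) `
       Poly_Mapping.keys (shuffle_forest {#T#} {#t#} :: forest \<Rightarrow>\<^sub>0 'k))"
  using assms
  by (simp add: keys_scale keys_sum_mset_nonneg keys_mult_basis nonneg_coeffs_sum_mset
      nonneg_coeffs_mult_basis nonneg_coeffs_shuffle_forest add_mset_commute)

lemma keys_shuffle_tree:
  "Poly_Mapping.keys (shuffle_forest {#Node f#} {#Node f'#} :: forest \<Rightarrow>\<^sub>0 'k::field_char_0) =
    (\<lambda>G. {#Node G#}) ` (Poly_Mapping.keys (shuffle_forest f {#Node f'#} :: forest \<Rightarrow>\<^sub>0 'k) \<union>
                     Poly_Mapping.keys (shuffle_forest {#Node f#} f' :: forest \<Rightarrow>\<^sub>0 'k))"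
  by (simp add: keys_add_nonneg keys_B_plus_eq nonneg_coeffs_B_plus nonneg_coeffs_shuffle_forest image_Un)

lemma keys_shuffle_treeE:
  assumes "H \<in> Poly_Mapping.keys (shuffle_forest {#T#} {#t#} :: forest \<Rightarrow>\<^sub>0 'k::field_char_0)"
  obtains U where "H = {#U#}"
  using assms by (cases T; cases t) (auto simp: keys_shuffle_tree simp del: shuffle_forest.simps)

text \<open>A shuffle merges one tree of \<open>F\<close> and one tree of \<open>F'\<close> into a single tree and keeps all the
  others. In particular, among the shuffles of non-empty forests, only those of two trees contain
  a single tree.\<close>

lemma size_keys_shuffle_forest:
  assumes "F \<noteq> {#}" "F' \<noteq> {#}"
    and "G \<in> Poly_Mapping.keys (shuffle_forest F F' :: forest \<Rightarrow>\<^sub>0 'k::field_char_0)"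
  shows "size G + 1 = size F + size F'"
proof -
  consider "size F + size F' \<ge> 3" | T t where "F = {#T#}" "F' = {#t#}"
  proof (cases "size F + size F' \<ge> 3")
    case False
    moreover have "size F > 0" "size F' > 0" using assms by (auto simp: nonempty_has_size)
    ultimately have "size F = 1" "size F' = 1" by linarith+
    then show ?thesis using that(2) by (metis One_nat_def size_1_singleton_mset)
  qed (use that(1) in blast)
  then show ?thesis
  proof cases
    case 1
    then obtain T t U where Tt: "T \<in># F" "t \<in># F'" "G = {#U#} + ((F - {#T#}) + (F' - {#t#}))"
      using assms keys_shuffle_forest[of F F', where 'k = 'k] by (auto elim: keys_shuffle_treeE)
    moreover have "size F > 0" "size F' > 0" using assms by (auto simp: nonempty_has_size)
    ultimately show ?thesis unfolding Tt(3) size_union size_single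
      by (simp add: size_Diff_singleton[OF Tt(1)] size_Diff_singleton[OF Tt(2)])
  next
    case 2
    then show ?thesis using assms(3) by (auto elim: keys_shuffle_treeE)
  qed
qed

section \<open>Primitive trees\<close>

lemma lookup_coproduct_basis:
  "Poly_Mapping.lookup (coproduct (basis F) :: _ \<Rightarrow>\<^sub>0 'k::field_char_0) (A, B)
    = Poly_Mapping.lookup (shuffle_forest A B) F"
proof -
  have "pairing (coproduct (basis F)) (tensor (basis A) (basis B)) =
      (pairing (basis F) (shuffle (basis A) (basis B)) :: 'k)"
    by (rule pairing_coproduct)
  moreover have "pairing (basis F) x = Poly_Mapping.lookup x F" for x :: "forest \<Rightarrow>\<^sub>0 'k"
    by (auto simp: pairing_def lookup_single when_def in_keys_iff if_distrib[of "\<lambda>c. c * _"] cong: if_cong)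
  ultimately show ?thesis
    by (simp add: pairing_tensor_right shuffle_def)
qed

lemma primitive_tree_iff_not_in_shuffle:
  "primitive_tree TYPE('k::field_char_0) T \<longleftrightarrow>
    (\<forall>t t'. {#T#} \<notin> Poly_Mapping.keys (shuffle_forest {#t#} {#t'#} :: forest \<Rightarrow>\<^sub>0 'k))" (is "?l \<longleftrightarrow> ?r")
proof -
  have tens: "Poly_Mapping.lookup (tensor (basis {#T#}) (basis {#}) + tensor (basis {#}) (basis {#T#}) :: _ \<Rightarrow>\<^sub>0 'k) (A, B)
     = (if A = {#T#} \<and> B = {#} \<or> A = {#} \<and> B = {#T#} then 1 else 0)" for A B
    by (auto simp: tensor_def lookup_add lookup_single when_def)
  have "?l \<longleftrightarrow> (\<forall>A B. Poly_Mapping.lookup (shuffle_forest A B :: _ \<Rightarrow>\<^sub>0 'k) {#T#}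
     = (if A = {#T#} \<and> B = {#} \<or> A = {#} \<and> B = {#T#} then 1 else 0))"
    by (simp add: primitive_tree_def poly_mapping_eq_iff fun_eq_iff lookup_coproduct_basis tens del: single_one)
  also have "\<dots> \<longleftrightarrow> (\<forall>A B. A \<noteq> {#} \<and> B \<noteq> {#} \<longrightarrow>
      {#T#} \<notin> Poly_Mapping.keys (shuffle_forest A B :: _ \<Rightarrow>\<^sub>0 'k))"
  proof (intro all_cong1)
    fix A B
    show "(Poly_Mapping.lookup (shuffle_forest A B :: _ \<Rightarrow>\<^sub>0 'k) {#T#}
       = (if A = {#T#} \<and> B = {#} \<or> A = {#} \<and> B = {#T#} then 1 else 0)) \<longleftrightarrow>
       (A \<noteq> {#} \<and> B \<noteq> {#} \<longrightarrow> {#T#} \<notin> Poly_Mapping.keys (shuffle_forest A B :: _ \<Rightarrow>\<^sub>0 'k))"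
      by (cases "A = {#}"; cases "B = {#}")
        (auto simp: lookup_single when_def in_keys_iff simp del: shuffle_forest.simps(3,4) single_one)
  qed
  also have "\<dots> \<longleftrightarrow> ?r"
  proof
    assume r: ?r
    have False if "A \<noteq> {#}" "B \<noteq> {#}" "{#T#} \<in> Poly_Mapping.keys (shuffle_forest A B :: _ \<Rightarrow>\<^sub>0 'k)" for A B
    proof -
      have "size A + size B = 2" "size A > 0" "size B > 0"
        using size_keys_shuffle_forest[OF that] that by (auto simp: nonempty_has_size)
      then have "size A = 1" "size B = 1" by linarith+
      then obtain t t' where "A = {#t#}" "B = {#t'#}" by (metis One_nat_def size_1_singleton_mset)
      then show False using r that by blast
    qed
    then show "\<forall>A B. A \<noteq> {#} \<and> B \<noteq> {#} \<longrightarrow> {#T#} \<notin> Poly_Mapping.keys (shuffle_forest A B :: _ \<Rightarrow>\<^sub>0 'k)"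
      by blast
  qed (simp del: shuffle_forest.simps)
  finally show ?thesis .
qed

text \<open>A single tree \<open>G = {#t#}\<close> occurs in its shuffle with the empty forest. Otherwise the shuffle
  must merge some tree \<open>a\<close> of \<open>f\<close> with \<open>t\<close> into a tree \<open>T\<close> of \<open>G\<close>, which is therefore not
  primitive. Conversely, given such a \<open>T\<close> in a forest \<open>G\<close> that is not a single tree, replacing
  \<open>T\<close> by \<open>a\<close> in \<open>G\<close> yields the forest \<open>f\<close>.\<close>

lemma in_shuffle_with_tree_iff:
  "(\<exists>f t. G \<in> Poly_Mapping.keys (shuffle_forest f {#t#} :: forest \<Rightarrow>\<^sub>0 'k::field_char_0)) \<longleftrightarrow>
    size G = 1 \<or> (\<exists>T\<in>#G. \<not> primitive_tree TYPE('k) T)" (is "?l \<longleftrightarrow> ?r")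
proof
  assume ?l
  then obtain f t where G: "G \<in> Poly_Mapping.keys (shuffle_forest f {#t#} :: forest \<Rightarrow>\<^sub>0 'k)" by blast
  consider "f = {#}" | "size f = 1" | "size f \<ge> 2" 
    by (cases f) (auto simp: Suc_le_eq nonempty_has_size)
  then show ?r
  proof cases
    case 1
    then show ?thesis using G by simp
  next
    case 2
    then have "f \<noteq> {#}" by auto
    then show ?thesis using size_keys_shuffle_forest[OF _ _ G] 2 by simp
  next
    case 3
    then have "f \<noteq> {#}" by auto
    have "G \<in> (\<Union>T\<in>set_mset f. \<Union>t'\<in>set_mset {#t#}. (\<lambda>H. H + ((f - {#T#}) + ({#t#} - {#t'#}))) `
        Poly_Mapping.keys (shuffle_forest {#T#} {#t'#} :: forest \<Rightarrow>\<^sub>0 'k))"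
      using G 3 \<open>f \<noteq> {#}\<close> by (subst keys_shuffle_forest[symmetric]) simp_all
    then obtain T H where H: "T \<in># f" "H \<in> Poly_Mapping.keys (shuffle_forest {#T#} {#t#} :: forest \<Rightarrow>\<^sub>0 'k)"
      "G = H + (f - {#T#})"
      by (auto simp del: shuffle_forest.simps)
    from H(2) obtain U where U: "H = {#U#}" by (rule keys_shuffle_treeE)
    then have "U \<in># G" using H(3) by simp
    moreover have "\<not> primitive_tree TYPE('k) U"
      using H(2) unfolding primitive_tree_iff_not_in_shuffle U by blast
    ultimately show ?thesis by blast
  qed
next
  assume ?r
  show ?l
  proof (cases "size G = 1")
    case True
    then obtain t where "G = {#t#}" by (metis One_nat_def size_1_singleton_mset)
    then have "G \<in> Poly_Mapping.keys (shuffle_forest {#} {#t#} :: forest \<Rightarrow>\<^sub>0 'k)" by simp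
    then show ?thesis by blast
  next
    case False
    with \<open>?r\<close> obtain T where T: "T \<in># G" "\<not> primitive_tree TYPE('k) T" by blast
    then obtain a b where ab: "{#T#} \<in> Poly_Mapping.keys (shuffle_forest {#a#} {#b#} :: forest \<Rightarrow>\<^sub>0 'k)"
      by (auto simp: primitive_tree_iff_not_in_shuffle)
    have "G - {#T#} \<noteq> {#}" using T False by (metis insert_DiffM One_nat_def size_single)
    then have "size (add_mset a (G - {#T#})) + size {#b#} \<ge> 3"
      by (simp add: Suc_le_eq nonempty_has_size)
    then have "{#T#} + ((add_mset a (G - {#T#}) - {#a#}) + ({#b#} - {#b#})) \<in>
        Poly_Mapping.keys (shuffle_forest (add_mset a (G - {#T#})) {#b#} :: forest \<Rightarrow>\<^sub>0 'k)"
      using ab keys_shuffle_forest[of "add_mset a (G - {#T#})" "{#b#}", where 'k = 'k]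
      by (auto simp del: shuffle_forest.simps)
    then show ?thesis using T(1) by auto
  qed
qed

text \<open>The combinatorial description of primitive trees. Occurrence of \<open>Node G\<close> in the shuffle of
  two trees unfolds to occurrence of \<open>G\<close> after one of the two roots is removed; by commutativity it
  does not matter which one.\<close>

theorem primitive_tree_Node_iff:
  "primitive_tree TYPE('k::field_char_0) (Node G) \<longleftrightarrow>
    size G \<noteq> 1 \<and> (\<forall>T\<in>#G. primitive_tree TYPE('k) T)"
proof -
  have ex_tree: "(\<exists>t. Q t) \<longleftrightarrow> (\<exists>f. Q (Node f))" for Q
    by (metis tree.exhaust)
  have "\<not> primitive_tree TYPE('k) (Node G) \<longleftrightarrow>
     (\<exists>f f'. G \<in> Poly_Mapping.keys (shuffle_forest f {#Node f'#} :: forest \<Rightarrow>\<^sub>0 'k)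
           \<or> G \<in> Poly_Mapping.keys (shuffle_forest {#Node f#} f' :: forest \<Rightarrow>\<^sub>0 'k))"
    by (simp add: primitive_tree_iff_not_in_shuffle keys_shuffle_tree ex_tree image_iff
        del: shuffle_forest.simps)
  also have "\<dots> \<longleftrightarrow> (\<exists>f t. G \<in> Poly_Mapping.keys (shuffle_forest f {#t#} :: forest \<Rightarrow>\<^sub>0 'k))"
    by (metis shuffle_forest_commute tree.exhaust)
  finally show ?thesis unfolding in_shuffle_with_tree_iff by blast
qed

section \<open>Counting multisets\<close>

lemma count_image_mset_eq_size_filter: "count (image_mset w G) m = size {#x \<in># G. w x = m#}"
  by (induction G) auto

text \<open>Splitting \<open>G\<close> into its parts over the values of \<open>w\<close> is a bijection onto the families that
  consist, for each value \<open>m\<close>, of a multiset of \<open>count M m\<close> elements of weight \<open>m\<close>. The inverse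
  adds up the family, and each factor is a number of combinations with repetition.\<close>

lemma card_multisets_with_image:
  fixes w :: "'a \<Rightarrow> 'b"
  assumes fin: "\<And>m. m \<in># M \<Longrightarrow> finite {x \<in> A. w x = m}"
  shows "card {G. set_mset G \<subseteq> A \<and> image_mset w G = M} =
    (\<Prod>m\<in>set_mset M. (card {x \<in> A. w x = m} + count M m - 1) choose count M m)"
proof -
  let ?S = "set_mset M"
  let ?X = "{G. set_mset G \<subseteq> A \<and> image_mset w G = M}"
  let ?Y = "\<Pi>\<^sub>E m\<in>?S. multisets_of_size {x \<in> A. w x = m} (count M m)"
  let ?split = "\<lambda>G. \<lambda>m\<in>?S. {#x \<in># G. w x = m#}"
  have join_filter: "{#x \<in># (\<Sum>i\<in>?S. g i). w x = m#} = g m" if g: "g \<in> ?Y" and m: "m \<in># M" for g m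
  proof (rule multiset_eqI)
    fix x
    have w: "w y = i" if "y \<in># g i" "i \<in># M" for y i
      using PiE_mem[OF g \<open>i \<in># M\<close>] that by (auto simp: multisets_of_size_def)
    (* Only the member of the family over w x can contain x. *)
    have "count (g i) x = 0" if "i \<in># M" "i \<noteq> w x" for i
      using w[of x i] that by (auto simp: count_eq_zero_iff)
    then have "(\<Sum>i\<in>?S. count (g i) x) = (\<Sum>i\<in>?S. if i = w x then count (g i) x else 0)"
      by (intro sum.cong) auto
    then show "count {#x \<in># (\<Sum>i\<in>?S. g i). w x = m#} x = count (g m) x"
      using w[of x m] m by (auto simp: count_sum count_eq_zero_iff)
  qed
  have "bij_betw ?split ?X ?Y"
  proof (rule bij_betw_byWitness[where f' = "\<lambda>g. \<Sum>m\<in>?S. g m"])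
    show "\<forall>G\<in>?X. (\<Sum>m\<in>?S. ?split G m) = G"
    proof (intro ballI multiset_eqI)
      fix G x assume G: "G \<in> ?X"
      then have "x \<in># G \<Longrightarrow> w x \<in># M" by auto
      then show "count (\<Sum>m\<in>?S. ?split G m) x = count G x"
        by (auto simp: count_sum count_eq_zero_iff)
    qed
    show "\<forall>g\<in>?Y. ?split (\<Sum>m\<in>?S. g m) = g"
    proof
      fix g assume g: "g \<in> ?Y"
      show "?split (\<Sum>m\<in>?S. g m) = g"
        by (rule ext) (use join_filter[OF g] PiE_arb[OF g] in auto)
    qed
    show "?split ` ?X \<subseteq> ?Y"
      by (auto simp: multisets_of_size_def simp flip: count_image_mset_eq_size_filter)
    show "(\<lambda>g. \<Sum>m\<in>?S. g m) ` ?Y \<subseteq> ?X"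
    proof clarify
      fix g assume g: "g \<in> ?Y"
      have "set_mset (\<Sum>m\<in>?S. g m) \<subseteq> A"
        using PiE_mem[OF g] by (fastforce simp: set_mset_sum multisets_of_size_def)
      moreover have "image_mset w (\<Sum>m\<in>?S. g m) = M"
      proof (rule multiset_eqI)
        fix m
        show "count (image_mset w (\<Sum>m\<in>?S. g m)) m = count M m"
        proof (cases "m \<in># M")
          case True
          then show ?thesis
            using PiE_mem[OF g] join_filter[OF g]
            by (simp add: count_image_mset_eq_size_filter multisets_of_size_def)
        next
          case False
          then have "m \<notin># image_mset w (\<Sum>m\<in>?S. g m)"
            using PiE_mem[OF g] by (fastforce simp: set_mset_sum multisets_of_size_def)
          with False show ?thesis by (metis not_in_iff)
        qed
      qed
      ultimately show "set_mset (\<Sum>m\<in>?S. g m) \<subseteq> A \<and> image_mset w (\<Sum>m\<in>?S. g m) = M" by blast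
    qed
  qed
  then have "card ?X = card ?Y" by (rule bij_betw_same_card)
  also have "\<dots> = (\<Prod>m\<in>?S. card (multisets_of_size {x \<in> A. w x = m} (count M m)))"
    by (rule card_PiE) simp
  also have "\<dots> = (\<Prod>m\<in>?S. (card {x \<in> A. w x = m} + count M m - 1) choose count M m)"
    using fin by (intro prod.cong refl card_multisets_of_size)
  finally show ?thesis .
qed

section \<open>The recursion\<close>

lemma finite_trees: "finite {T. vertices T = n}"
proof (rule inj_on_finite)
  show "inj_on (\<lambda>T. {#T#}) {T. vertices T = n}" by (auto simp: inj_on_def)
  show "(\<lambda>T. {#T#}) ` {T. vertices T = n} \<subseteq> {F. forest_vertices F = n}" by auto
  show "finite {F. forest_vertices F = n}" by (rule finite_forests)
qed

lemma size_le_forest_vertices: "size F \<le> forest_vertices F"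
proof (induction F)
  case (add T F)
  then show ?case using vertices_pos[of T] by simp
qed simp

text \<open>The forests of children of the root in primitive trees with \<open>n + 1\<close> vertices.\<close>

definition primitive_children :: "'k::field_char_0 itself \<Rightarrow> nat \<Rightarrow> forest set" where
  "primitive_children K n =
     {G. set_mset G \<subseteq> {T. primitive_tree K T} \<and> size G \<noteq> 1 \<and> forest_vertices G = n}"

lemma num_primitive_trees_Suc:
  "num_primitive_trees TYPE('k::field_char_0) (Suc n) = card (primitive_children TYPE('k) n)"
proof -
  have "{T. vertices T = Suc n \<and> primitive_tree TYPE('k) T} = Node ` primitive_children TYPE('k) n"
  proof (intro set_eqI)
    fix T :: tree
    show "T \<in> {T. vertices T = Suc n \<and> primitive_tree TYPE('k) T} \<longleftrightarrow> T \<in> Node ` primitive_children TYPE('k) n"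
      by (cases T) (auto simp: primitive_children_def primitive_tree_Node_iff vertices_Node simp del: vertices.simps)
  qed
  then show ?thesis by (simp add: num_primitive_trees_def card_image inj_on_def)
qed

text \<open>Identifies the weakly decreasing lists that index the recursion with multisets.\<close>

lemma rev_sorted_list_of_multiset_eq_iff:
  "rev (sorted_list_of_multiset M) = ns \<longleftrightarrow> sorted_wrt (\<ge>) ns \<and> mset ns = M"
proof
  assume ns: "rev (sorted_list_of_multiset M) = ns"
  then have "rev ns = sorted_list_of_multiset M" by auto
  then have "sorted (rev ns)" by simp
  then show "sorted_wrt (\<ge>) ns \<and> mset ns = M"
    using ns by (auto simp: sorted_wrt_rev)
next
  assume ns: "sorted_wrt (\<ge>) ns \<and> mset ns = M"
  then have "sort ns = rev ns"
    by (intro properties_for_sort) (auto simp: sorted_wrt_rev)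
  with ns show "rev (sorted_list_of_multiset M) = ns" by auto
qed

theorem proposition2p15:
  fixes p :: "nat \<Rightarrow> nat"
  defines "p \<equiv> num_primitive_trees TYPE('k::field_char_0)"
  shows "p 0 = 0 \<and> p 1 = 1 \<and> p 2 = 0 \<and>
    (\<forall>n\<ge>2. p (n + 1) =
      (\<Sum>k = 2..n. \<Sum>ns \<in> {ns. length ns = k \<and> sorted_wrt (\<ge>) ns \<and> (\<forall>m\<in>set ns. m \<ge> 1) \<and> sum_list ns = n}.
        \<Prod>m\<in>set ns. (p m + count_list ns m - 1) choose count_list ns m))"
proof (intro conjI allI impI)
  let ?P = "{T. primitive_tree TYPE('k) T}"
  have card_P: "card {T \<in> ?P. vertices T = m} = p m" for m
    by (simp add: p_def num_primitive_trees_def conj_commute)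
  show "p 0 = 0"
    by (simp add: p_def num_primitive_trees_def vertices_pos[THEN less_imp_neq, THEN not_sym])
  have "primitive_children TYPE('k) 0 = {{#}}"
    by (auto simp: primitive_children_def)
  then show "p 1 = 1"
    by (simp add: p_def num_primitive_trees_Suc)
  (* A single tree cannot hang below a primitive root, so a one-vertex forest cannot either. *)
  have "size G = 1" if "forest_vertices G = 1" for G
  proof -
    have "G \<noteq> {#}" "size G \<le> 1" using that size_le_forest_vertices[of G] by auto
    then show ?thesis by (simp add: nonempty_has_size)
  qed
  then have "primitive_children TYPE('k) 1 = {}"
    by (auto simp: primitive_children_def)
  then show "p 2 = 0"
    by (simp add: p_def num_primitive_trees_Suc numeral_2_eq_2)
  fix n :: nat assume n: "n \<ge> 2"
  let ?S = "primitive_children TYPE('k) n"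
  let ?L = "\<lambda>k. {ns :: nat list. length ns = k \<and> sorted_wrt (\<ge>) ns \<and> (\<forall>m\<in>set ns. m \<ge> 1) \<and> sum_list ns = n}"
  let ?shape = "\<lambda>G. rev (sorted_list_of_multiset (image_mset vertices G))"
  have fin_S: "finite ?S"
    by (rule finite_subset[OF _ finite_forests[of n]]) (auto simp: primitive_children_def)
  have fin_L: "finite (?L k)" for k
  proof (rule finite_subset)
    show "?L k \<subseteq> {ns. set ns \<subseteq> {..n} \<and> length ns = k}" by (auto intro: member_le_sum_list)
  qed (rule finite_lists_length_eq, simp)
  have shapes: "?shape ` {G \<in> ?S. size G = k} \<subseteq> ?L k" for k
  proof clarify
    fix G assume G: "G \<in> ?S" "k = size G"
    have "sorted_wrt (\<ge>) (?shape G) \<and> mset (?shape G) = image_mset vertices G"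
      by (rule iffD1[OF rev_sorted_list_of_multiset_eq_iff refl])
    moreover have "sum_list (?shape G) = n"
      using G by (simp add: primitive_children_def forest_vertices_def flip: sum_mset_sum_list)
    moreover have "\<forall>m\<in>set (?shape G). m \<ge> 1"
      using vertices_pos by (auto simp: Suc_le_eq)
    ultimately show "length (?shape G) = size G \<and> sorted_wrt (\<ge>) (?shape G) \<and> (\<forall>m\<in>set (?shape G). m \<ge> 1) \<and> sum_list (?shape G) = n"
      by (metis size_mset size_image_mset)
  qed
  have fibre: "card {G \<in> {G \<in> ?S. size G = k}. ?shape G = ns} =
      (\<Prod>m\<in>set ns. (p m + count_list ns m - 1) choose count_list ns m)" if k: "k \<ge> 2" and ns: "ns \<in> ?L k" for k ns
  proof -
    have "{G \<in> {G \<in> ?S. size G = k}. ?shape G = ns} = {G. set_mset G \<subseteq> ?P \<and> image_mset vertices G = mset ns}"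
      (is "?A = ?B")
    proof (intro equalityI subsetI)
      fix G assume "G \<in> ?A"
      then show "G \<in> ?B" unfolding rev_sorted_list_of_multiset_eq_iff by (auto simp: primitive_children_def)
    next
      fix G assume G: "G \<in> ?B"
      then have vertices_G: "image_mset vertices G = mset ns" by simp
      have "size G = k" using arg_cong[OF vertices_G, of size] ns by simp
      moreover have "forest_vertices G = n"
        using ns unfolding forest_vertices_def vertices_G by (simp add: sum_mset_sum_list)
      moreover have "?shape G = ns"
        unfolding rev_sorted_list_of_multiset_eq_iff using vertices_G ns by simp
      ultimately show "G \<in> ?A"
        using G k by (simp add: primitive_children_def)
    qed
    also have "card \<dots> = (\<Prod>m\<in>set ns. (p m + count_list ns m - 1) choose count_list ns m)"
      by (subst card_multisets_with_image)
        (auto simp: card_P[simplified] count_mset intro: finite_subset[OF _ finite_trees])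
    finally show ?thesis .
  qed
  have sizes: "size ` ?S \<subseteq> {2..n}"
  proof clarify
    fix G assume G: "G \<in> ?S"
    then have "size G \<noteq> 0" "size G \<noteq> 1" "size G \<le> n"
      using n size_le_forest_vertices[of G] by (auto simp: primitive_children_def)
    then have "2 \<le> size G" by linarith
    with \<open>size G \<le> n\<close> show "size G \<in> {2..n}" by simp
  qed
  (* The children are grouped first by their number, then by their numbers of vertices. *)
  have "p (n + 1) = (\<Sum>G\<in>?S. 1)"
    by (simp add: p_def num_primitive_trees_Suc)
  also have "\<dots> = (\<Sum>k = 2..n. \<Sum>G\<in>{G \<in> ?S. size G = k}. 1)"
    by (rule sum.group[OF fin_S _ sizes, symmetric]) simp
  also have "\<dots> = (\<Sum>k = 2..n. \<Sum>ns\<in>?L k. \<Sum>G\<in>{G \<in> {G \<in> ?S. size G = k}. ?shape G = ns}. 1)"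
    by (intro sum.cong refl sum.group[OF _ fin_L shapes, symmetric]) (use fin_S in simp)
  also have "\<dots> = (\<Sum>k = 2..n. \<Sum>ns\<in>?L k. \<Prod>m\<in>set ns. (p m + count_list ns m - 1) choose count_list ns m)"
    by (intro sum.cong refl) (use fibre in \<open>auto simp flip: card_eq_sum\<close>)
  finally show "p (n + 1) = (\<Sum>k = 2..n. \<Sum>ns\<in>?L k. \<Prod>m\<in>set ns. (p m + count_list ns m - 1) choose count_list ns m)" .
qed

end
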